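(* Let $p$ be a prime number, let $\sigma_o$ be the conjugacy class of $\begin{pmatrix}1&1\\0&1\end{pmatrix}$ in $\mathrm{SL}_2(\mathbb{Z})$, and suppose $\varepsilon\in\{\pm1\}$. For all $n\in\mathbb{Z}$, $$\mathbf{e}_p(\varepsilon\sigma_o^n)=\begin{cases}\varepsilon^p\sigma_o^{np}&p\nmid n,\\ p\,[\varepsilon\sigma_o^n]&p\mid n,\end{cases}$$ and $$T_p(\varepsilon\sigma_o^n)=\begin{cases}[\varepsilon\sigma_o^{np}]+[\varepsilon^p\sigma_o^n]&p\nmid n,\\ [\varepsilon\sigma_o^{np}]+p\,[\varepsilon\sigma_o^{n/p}]&p\mid n.\end{cases}$$ Here $\varepsilon$ multiplies matrices (so $[\varepsilon\sigma_o^k]$ is the conjugacy class of $\varepsilon\begin{pmatrix}1&k\\0&1\end{pmatrix}$), while $p$ is an integer coefficient.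
   Context: For a group $\Gamma$, $\lambda(\Gamma)$ is its set of conjugacy classes and $\mathbb{Z}\lambda(\Gamma)$ the free abelian group on it. A homomorphism $\psi$ induces $\psi_*$ on $\mathbb{Z}\lambda$. For a finite index subgroup $\pi:\Gamma'\hookrightarrow\Gamma$, the pullback $\pi^*:\mathbb{Z}\lambda(\Gamma)\to\mathbb{Z}\lambda(\Gamma')$ takes $[\alpha]$ to $\sum_{s\in\Gamma'\backslash\Gamma/\langle\alpha\rangle}[\gamma_s\alpha^{d_s}\gamma_s^{-1}]$, with $\gamma_s$ representing $s$ and $d_s=\min\{k>0:\gamma_s\alpha^k\gamma_s^{-1}\in\Gamma'\}$. Let $\pi:\Gamma_0(p)\hookrightarrow\mathrm{SL}_2(\mathbb{Z})$ be the inclusion of the subgroup of matrices upper triangular mod $p$. On $\mathbb{Z}\lambda(\mathrm{SL}_2(\mathbb{Z}))$, $\mathbf{e}_p=\pi_*\pi^*-\mathrm{id}$ and $T_p=\pi^{op}_*\circ\pi^*$, where $\pi^{op}:\Gamma_0(p)\to\mathrm{SL}_2(\mathbb{Z})$, $\gamma\mapsto g_p\gamma g_p^{-1}$, $g_p=\mathrm{diag}(p,1)$. *)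

theory Defs
  imports
    "HOL-Analysis.Analysis"
    "HOL-Algebra.Coset"
    "HOL-Algebra.Generated_Groups"
    "HOL-Library.Poly_Mapping"
begin

section \<open>The free abelian group on the conjugacy classes of a group\<close>

definition conj_class :: "('a, 'm) monoid_scheme \<Rightarrow> 'a \<Rightarrow> 'a set" where
  "conj_class G a = {g \<otimes>\<^bsub>G\<^esub> a \<otimes>\<^bsub>G\<^esub> inv\<^bsub>G\<^esub> g | g. g \<in> carrier G}"

text \<open>
  A conjugacy class is a set of group elements, so the free abelian group on the conjugacy
  classes of a group over \<^typ>\<open>'a\<close> consists of the elements of \<^typ>\<open>'a set \<Rightarrow>\<^sub>0 int\<close> that are
  supported on such classes; the generator of a class \<open>C\<close> is \<open>frag_of C\<close>. The homomorphisms
  below are the linear extensions (\<^const>\<open>frag_extend\<close>) of their values on generators; their values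
  at sets that are not conjugacy classes are irrelevant. A representative of a class, and
  likewise of a double coset, is chosen by \<open>SOME\<close>; the results do not depend on that choice.
\<close>

definition pushforward ::
  "('b, 'm) monoid_scheme \<Rightarrow> ('a \<Rightarrow> 'b) \<Rightarrow> ('a set \<Rightarrow>\<^sub>0 int) \<Rightarrow> ('b set \<Rightarrow>\<^sub>0 int)" where
  "pushforward K \<psi> = frag_extend (\<lambda>C. frag_of (conj_class K (\<psi> (SOME a. a \<in> C))))"

definition double_cosets :: "('a, 'm) monoid_scheme \<Rightarrow> 'a set \<Rightarrow> 'a set \<Rightarrow> 'a set set" where
  "double_cosets G H K = {(H #>\<^bsub>G\<^esub> g) <#>\<^bsub>G\<^esub> K | g. g \<in> carrier G}"

definition return_time :: "('a, 'm) monoid_scheme \<Rightarrow> 'a set \<Rightarrow> 'a \<Rightarrow> 'a \<Rightarrow> nat" where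
  "return_time G H \<alpha> g =
     (LEAST k. 0 < k \<and> g \<otimes>\<^bsub>G\<^esub> (\<alpha> [^]\<^bsub>G\<^esub> k) \<otimes>\<^bsub>G\<^esub> inv\<^bsub>G\<^esub> g \<in> H)"

definition pullback_elem :: "('a, 'm) monoid_scheme \<Rightarrow> 'a set \<Rightarrow> 'a \<Rightarrow> ('a set \<Rightarrow>\<^sub>0 int)" where
  "pullback_elem G H \<alpha> =
     (\<Sum>s \<in> double_cosets G H (generate G {\<alpha>}).
        let g = (SOME g. g \<in> s) in
          frag_of (conj_class (G\<lparr>carrier := H\<rparr>)
            (g \<otimes>\<^bsub>G\<^esub> (\<alpha> [^]\<^bsub>G\<^esub> return_time G H \<alpha> g) \<otimes>\<^bsub>G\<^esub> inv\<^bsub>G\<^esub> g)))"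

text \<open>Only meaningful for a subgroup \<open>H\<close> of finite index in \<open>G\<close>.\<close>

definition pullback ::
  "('a, 'm) monoid_scheme \<Rightarrow> 'a set \<Rightarrow> ('a set \<Rightarrow>\<^sub>0 int) \<Rightarrow> ('a set \<Rightarrow>\<^sub>0 int)" where
  "pullback G H = frag_extend (\<lambda>C. pullback_elem G H (SOME a. a \<in> C))"

section \<open>The modular group and its Hecke operators\<close>

definition SL2Z :: "(int^2^2) monoid" where
  "SL2Z = \<lparr>carrier = {A. det A = 1}, monoid.mult = (**), one = mat 1\<rparr>"

definition Gamma0 :: "nat \<Rightarrow> (int^2^2) set" where
  "Gamma0 p = {A \<in> carrier SL2Z. int p dvd A $ 2 $ 1}"

definition g_mat :: "nat \<Rightarrow> rat^2^2" where
  "g_mat p = vector [vector [of_nat p, 0], vector [0, 1]]"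

text \<open>
  The conjugation takes place over the rationals. On \<^term>\<open>Gamma0 p\<close> with \<open>p > 0\<close> the result is an
  integral matrix, and \<open>pi_op\<close> returns that integral matrix.
\<close>

definition pi_op :: "nat \<Rightarrow> int^2^2 \<Rightarrow> int^2^2" where
  "pi_op p A = (THE B. map_matrix rat_of_int B =
                       g_mat p ** map_matrix rat_of_int A ** matrix_inv (g_mat p))"

definition e_op :: "nat \<Rightarrow> ((int^2^2) set \<Rightarrow>\<^sub>0 int) \<Rightarrow> ((int^2^2) set \<Rightarrow>\<^sub>0 int)" where
  "e_op p x = pushforward SL2Z (\<lambda>A. A) (pullback SL2Z (Gamma0 p) x) - x"

definition T_op :: "nat \<Rightarrow> ((int^2^2) set \<Rightarrow>\<^sub>0 int) \<Rightarrow> ((int^2^2) set \<Rightarrow>\<^sub>0 int)" where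
  "T_op p x = pushforward SL2Z (pi_op p) (pullback SL2Z (Gamma0 p) x)"

text \<open>The class \<open>[\<epsilon> \<sigma>\<^sub>o\<^sup>k]\<close>, as a generator of the free abelian group.\<close>

definition sigma_class :: "int \<Rightarrow> int \<Rightarrow> ((int^2^2) set \<Rightarrow>\<^sub>0 int)" where
  "sigma_class \<epsilon> k =
     frag_of (conj_class SL2Z (map_matrix ((*) \<epsilon>) (vector [vector [1, k], vector [0, 1]])))"

end

(* The right cosets of Gamma0(p) form the projective line over F_p, on which the parabolic
   element eps * (1 n; 0 1) fixes (0 : 1) and sends (1 : d) to (1 : d + n). If p does not divide n
   there are therefore two orbits, of lengths 1 and p; otherwise there are p + 1 fixed points.
   Conjugating the powers by the representatives (0 -1; 1 d) gives lower triangular matrices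
   s * (1 0; -m 1), which are conjugate to s * (1 m; 0 1) in SL2(Z) and go to
   s * (1 0; -m/p 1) under pi_op. *)

theory Submission
  imports Defs "HOL-Number_Theory.Cong"
begin

section \<open>Pullback along a double coset transversal\<close>

text \<open>The obstacle is choice: \<open>pushforward\<close> and \<open>pullback\<close> pick a
  representative of each class by \<open>SOME\<close>, and \<open>pullback_elem\<close> picks one of
  each double coset, so nothing can be computed before independence of these choices is known. Hence
  the general group theory: the pullback of a class is a sum over any family that meets each double
  coset exactly once. The return time d_s is the length of the orbit of the coset, so the orbit of
  length p contributes a p-th power; this is the origin of \<epsilon>^p and of the exponent np. The
  fixed point (0 : 1) contributes the class itself, which is exactly what the subtraction of the
  identity in \<open>e_op\<close> removes. The upper and lower triangular terms stay separate
  classes of \<open>Gamma0 p\<close> until a degeneracy map is applied, because \<open>pi_op\<close>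
  treats them differently: it multiplies the parameter of the upper ones by p and divides that of
  the lower ones by p.\<close>

lemma (in group) inv_cancel_left:
  assumes "x \<in> carrier G" "y \<in> carrier G"
  shows "inv x \<otimes> (x \<otimes> y) = y" "x \<otimes> (inv x \<otimes> y) = y"
  using assms by (simp_all flip: m_assoc)

section \<open>Conjugacy classes and the maps induced on them\<close>

lemma (in group) conj_class_conj:
  assumes "a \<in> carrier G" "g \<in> carrier G"
  shows "conj_class G (g \<otimes> a \<otimes> inv g) = conj_class G a"
proof -
  have "\<exists>h'\<in>carrier G. h \<otimes> (g \<otimes> a \<otimes> inv g) \<otimes> inv h = h' \<otimes> a \<otimes> inv h'"
    if "h \<in> carrier G" for h
    using that assms by (intro bexI[of _ "h \<otimes> g"]) (auto simp: inv_mult_group m_assoc)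
  moreover have "\<exists>h'\<in>carrier G. h \<otimes> a \<otimes> inv h = h' \<otimes> (g \<otimes> a \<otimes> inv g) \<otimes> inv h'"
    if "h \<in> carrier G" for h
    using that assms
    by (intro bexI[of _ "h \<otimes> inv g"]) (auto simp: inv_mult_group m_assoc inv_cancel_left)
  ultimately show ?thesis
    unfolding conj_class_def by blast
qed

lemma (in group) conj_class_self:
  assumes "a \<in> carrier G"
  shows "a \<in> conj_class G a"
  unfolding conj_class_def using assms by (auto intro!: exI[of _ \<one>])

lemma (in group) some_conj_class:
  assumes "a \<in> carrier G"
  obtains g where "g \<in> carrier G" "(SOME b. b \<in> conj_class G a) = g \<otimes> a \<otimes> inv g"
proof -
  have "(SOME b. b \<in> conj_class G a) \<in> conj_class G a"
    using conj_class_self[OF assms] by (rule someI)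
  then show ?thesis
    using that unfolding conj_class_def by blast
qed

text \<open>The representative chosen by \<open>SOME\<close> is g a g^-1 for some g, and the
  homomorphism \<psi> sends it to a conjugate of \<psi> a, so the choice does not affect the target
  class.\<close>

lemma pushforward_conj_class:
  assumes "group G" "group K" "\<psi> \<in> hom G K" "a \<in> carrier G"
  shows "pushforward K \<psi> (frag_of (conj_class G a)) = frag_of (conj_class K (\<psi> a))"
proof -
  interpret G: group G by fact
  interpret K: group K by fact
  interpret group_hom G K \<psi>
    using assms by unfold_locales
  obtain g where g: "g \<in> carrier G"
      "(SOME b. b \<in> conj_class G a) = g \<otimes>\<^bsub>G\<^esub> a \<otimes>\<^bsub>G\<^esub> inv\<^bsub>G\<^esub> g"
    using G.some_conj_class assms(4) by blast
  show ?thesis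
    using g assms(4) by (simp add: pushforward_def K.conj_class_conj)
qed

text \<open>The subgroup generated by \<alpha> consists of the integer powers of \<alpha>, so g = h
  r \<alpha>^k with h in H can be solved for h. Double cosets thereby become a condition on
  exponents, which for matrices is a congruence.\<close>

lemma (in group) mem_double_coset_iff:
  assumes "subgroup H G" "\<alpha> \<in> carrier G" "r \<in> carrier G" "g \<in> carrier G"
  shows "g \<in> (H #> r) <#> generate G {\<alpha>} \<longleftrightarrow> (\<exists>k::int. g \<otimes> \<alpha> [^] k \<otimes> inv r \<in> H)"
proof
  assume "g \<in> (H #> r) <#> generate G {\<alpha>}"
  then obtain h k where h: "h \<in> H" "g = h \<otimes> r \<otimes> \<alpha> [^] (k::int)"
    using assms(2) by (auto simp: set_mult_def r_coset_def generate_pow)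
  have hc: "h \<in> carrier G"
    using subgroup.mem_carrier[OF assms(1) h(1)] .
  have "g \<otimes> \<alpha> [^] (-k) \<otimes> inv r = h"
    using h(2) hc assms(2,3) by (simp add: m_assoc int_pow_neg inv_cancel_left)
  then show "\<exists>k::int. g \<otimes> \<alpha> [^] k \<otimes> inv r \<in> H"
    using h(1) by blast
next
  assume "\<exists>k::int. g \<otimes> \<alpha> [^] k \<otimes> inv r \<in> H"
  then obtain k :: int where k: "g \<otimes> \<alpha> [^] k \<otimes> inv r \<in> H" by blast
  have "g = (g \<otimes> \<alpha> [^] k \<otimes> inv r) \<otimes> r \<otimes> \<alpha> [^] (-k)"
    using assms by (simp add: m_assoc int_pow_neg inv_cancel_left)
  then show "g \<in> (H #> r) <#> generate G {\<alpha>}"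
    using k assms(2) by (auto simp: set_mult_def r_coset_def generate_pow)
qed

lemma (in group) double_coset_self:
  assumes "subgroup H G" "\<alpha> \<in> carrier G" "g \<in> carrier G"
  shows "g \<in> (H #> g) <#> generate G {\<alpha>}"
  using assms by (subst mem_double_coset_iff)
    (auto intro!: exI[of _ "0::int"] simp: subgroup.one_closed)

lemma (in group) double_coset_carrier:
  assumes "subgroup H G" "\<alpha> \<in> carrier G" "r \<in> carrier G" "g \<in> (H #> r) <#> generate G {\<alpha>}"
  shows "g \<in> carrier G"
  using assms subgroup.subset[OF assms(1)]
  by (meson generate_incl empty_subsetI insert_subset r_coset_subset_G set_mult_closed subsetD)

lemma (in group) double_coset_eq:
  assumes H: "subgroup H G" and \<alpha>: "\<alpha> \<in> carrier G" and r: "r \<in> carrier G"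
    and g: "g \<in> (H #> r) <#> generate G {\<alpha>}"
  shows "(H #> g) <#> generate G {\<alpha>} = (H #> r) <#> generate G {\<alpha>}"
proof -
  have gc: "g \<in> carrier G"
    using double_coset_carrier assms by blast
  obtain k :: int where k: "g \<otimes> \<alpha> [^] k \<otimes> inv r \<in> H"
    using g mem_double_coset_iff[OF H \<alpha> r gc] by blast
  have "(\<exists>l::int. x \<otimes> \<alpha> [^] l \<otimes> inv g \<in> H) \<longleftrightarrow> (\<exists>l::int. x \<otimes> \<alpha> [^] l \<otimes> inv r \<in> H)"
    if x: "x \<in> carrier G" for x
  proof
    assume "\<exists>l::int. x \<otimes> \<alpha> [^] l \<otimes> inv g \<in> H"
    then obtain l :: int where "x \<otimes> \<alpha> [^] l \<otimes> inv g \<in> H" by blast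
    then have "(x \<otimes> \<alpha> [^] l \<otimes> inv g) \<otimes> (g \<otimes> \<alpha> [^] k \<otimes> inv r) \<in> H"
      using k H by (simp add: subgroup.m_closed)
    also have "(x \<otimes> \<alpha> [^] l \<otimes> inv g) \<otimes> (g \<otimes> \<alpha> [^] k \<otimes> inv r) = x \<otimes> \<alpha> [^] (l + k) \<otimes> inv r"
      using x gc r \<alpha> by (simp add: m_assoc int_pow_mult inv_cancel_left)
    finally show "\<exists>l::int. x \<otimes> \<alpha> [^] l \<otimes> inv r \<in> H" by blast
  next
    assume "\<exists>l::int. x \<otimes> \<alpha> [^] l \<otimes> inv r \<in> H"
    then obtain l :: int where "x \<otimes> \<alpha> [^] l \<otimes> inv r \<in> H" by blast
    then have "(x \<otimes> \<alpha> [^] l \<otimes> inv r) \<otimes> inv (g \<otimes> \<alpha> [^] k \<otimes> inv r) \<in> H"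
      using k H by (simp add: subgroup.m_closed subgroup.m_inv_closed)
    also have "(x \<otimes> \<alpha> [^] l \<otimes> inv r) \<otimes> inv (g \<otimes> \<alpha> [^] k \<otimes> inv r)
        = x \<otimes> (\<alpha> [^] l \<otimes> inv (\<alpha> [^] k)) \<otimes> inv g"
      using x gc r \<alpha> by (simp add: m_assoc inv_mult_group inv_cancel_left)
    also have "\<alpha> [^] l \<otimes> inv (\<alpha> [^] k) = \<alpha> [^] (l - k)"
      using \<alpha> by (simp add: int_pow_diff)
    finally show "\<exists>l::int. x \<otimes> \<alpha> [^] l \<otimes> inv g \<in> H" by blast
  qed
  then show ?thesis
    by (metis (no_types, lifting) mem_double_coset_iff[OF H \<alpha> gc] mem_double_coset_iff[OF H \<alpha> r]
        double_coset_carrier[OF H \<alpha> gc] double_coset_carrier[OF H \<alpha> r] subsetI subset_antisym)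
qed

text \<open>Write g = h r \<alpha>^k: the factor \<alpha>^k commutes with \<alpha>^d and cancels.
  The same h serves every d, so return times and return elements can be compared at once.\<close>

lemma (in group) conj_nat_pow_double_coset:
  assumes H: "subgroup H G" and \<alpha>: "\<alpha> \<in> carrier G" and r: "r \<in> carrier G"
    and g: "g \<in> (H #> r) <#> generate G {\<alpha>}"
  obtains h where "h \<in> H"
    "\<And>d::nat. g \<otimes> \<alpha> [^] d \<otimes> inv g = h \<otimes> (r \<otimes> \<alpha> [^] d \<otimes> inv r) \<otimes> inv h"
proof -
  obtain h k where h: "h \<in> H" "g = h \<otimes> r \<otimes> \<alpha> [^] (k::int)"
    using g \<alpha> by (auto simp: set_mult_def r_coset_def generate_pow)
  have hc: "h \<in> carrier G"
    using subgroup.mem_carrier[OF H h(1)] .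
  have "g \<otimes> \<alpha> [^] d \<otimes> inv g = h \<otimes> (r \<otimes> \<alpha> [^] d \<otimes> inv r) \<otimes> inv h" for d :: nat
  proof -
    have "\<alpha> [^] k \<otimes> (\<alpha> [^] d \<otimes> inv (\<alpha> [^] k)) = \<alpha> [^] k \<otimes> \<alpha> [^] int d \<otimes> inv (\<alpha> [^] k)"
      using \<alpha> by (simp add: m_assoc int_pow_int)
    also have "\<dots> = \<alpha> [^] (k + int d - k)"
      using \<alpha> by (simp only: int_pow_diff int_pow_mult)
    also have "\<dots> = \<alpha> [^] d"
      by (simp add: int_pow_int)
    finally have *: "\<alpha> [^] k \<otimes> (\<alpha> [^] d \<otimes> inv (\<alpha> [^] k)) = \<alpha> [^] d" .
    have "g \<otimes> \<alpha> [^] d \<otimes> inv g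
        = h \<otimes> (r \<otimes> (\<alpha> [^] k \<otimes> (\<alpha> [^] d \<otimes> inv (\<alpha> [^] k))) \<otimes> inv r) \<otimes> inv h"
      unfolding h(2) using hc r \<alpha> by (simp add: m_assoc inv_mult_group inv_cancel_left)
    then show ?thesis by (simp only: *)
  qed
  then show ?thesis using that h(1) by blast
qed

text \<open>Conjugation by an element of H preserves membership in H in both directions, so both
  \<open>LEAST\<close> operators range over the same exponents.\<close>

lemma (in group) return_time_double_coset:
  assumes H: "subgroup H G" and \<alpha>: "\<alpha> \<in> carrier G" and r: "r \<in> carrier G"
    and g: "g \<in> (H #> r) <#> generate G {\<alpha>}"
  shows "return_time G H \<alpha> g = return_time G H \<alpha> r"
proof -
  obtain h where h: "h \<in> H"
      "\<And>d::nat. g \<otimes> \<alpha> [^] d \<otimes> inv g = h \<otimes> (r \<otimes> \<alpha> [^] d \<otimes> inv r) \<otimes> inv h"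
    using conj_nat_pow_double_coset[OF assms] by blast
  have hc: "h \<in> carrier G"
    using subgroup.mem_carrier[OF H h(1)] .
  have "h \<otimes> x \<otimes> inv h \<in> H \<longleftrightarrow> x \<in> H" if x: "x \<in> carrier G" for x
  proof
    assume "h \<otimes> x \<otimes> inv h \<in> H"
    then have "inv h \<otimes> (h \<otimes> x \<otimes> inv h) \<otimes> h \<in> H"
      using h(1) H by (simp add: subgroup.m_closed subgroup.m_inv_closed)
    also have "inv h \<otimes> (h \<otimes> x \<otimes> inv h) \<otimes> h = x"
      using hc x by (simp add: m_assoc inv_cancel_left)
    finally show "x \<in> H" .
  qed (use h(1) H in \<open>simp add: subgroup.m_closed subgroup.m_inv_closed\<close>)
  then show ?thesis
    unfolding return_time_def h(2) using r \<alpha> by simp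
qed

definition pullback_term :: "('a, 'm) monoid_scheme \<Rightarrow> 'a set \<Rightarrow> 'a \<Rightarrow> 'a \<Rightarrow> ('a set \<Rightarrow>\<^sub>0 int)" where
  "pullback_term G H \<alpha> g = frag_of (conj_class (G\<lparr>carrier := H\<rparr>)
     (g \<otimes>\<^bsub>G\<^esub> (\<alpha> [^]\<^bsub>G\<^esub> return_time G H \<alpha> g) \<otimes>\<^bsub>G\<^esub> inv\<^bsub>G\<^esub> g))"

lemma (in group) return_time_in:
  assumes "\<exists>k::nat. 0 < k \<and> g \<otimes> \<alpha> [^] k \<otimes> inv g \<in> H"
  shows "g \<otimes> \<alpha> [^] return_time G H \<alpha> g \<otimes> inv g \<in> H"
  using LeastI_ex[OF assms] unfolding return_time_def by blast

text \<open>The two return elements are conjugate by an element of H. The assumption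
  \<open>ret\<close> ensures that the minimum in \<open>return_time\<close> is attained, so that the
  return element lies in H and has a class there.\<close>

lemma (in group) pullback_term_double_coset:
  assumes H: "subgroup H G" and \<alpha>: "\<alpha> \<in> carrier G" and r: "r \<in> carrier G"
    and g: "g \<in> (H #> r) <#> generate G {\<alpha>}"
    and ret: "\<exists>k::nat. 0 < k \<and> r \<otimes> \<alpha> [^] k \<otimes> inv r \<in> H"
  shows "pullback_term G H \<alpha> g = pullback_term G H \<alpha> r"
proof -
  obtain h where h: "h \<in> H"
      "\<And>d::nat. g \<otimes> \<alpha> [^] d \<otimes> inv g = h \<otimes> (r \<otimes> \<alpha> [^] d \<otimes> inv r) \<otimes> inv h"
    using conj_nat_pow_double_coset[OF H \<alpha> r g] by blast
  interpret H: group "G\<lparr>carrier := H\<rparr>"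
    using H by (rule subgroup_imp_group)
  have "conj_class (G\<lparr>carrier := H\<rparr>) (h \<otimes> x \<otimes> inv h) = conj_class (G\<lparr>carrier := H\<rparr>) x"
    if "x \<in> H" for x
    using H.conj_class_conj[of x h] that h(1) m_inv_consistent[OF H h(1)] by simp
  then show ?thesis
    using return_time_in[OF ret]
    by (simp add: pullback_term_def return_time_double_coset[OF H \<alpha> r g] h(2))
qed

text \<open>Existence in \<open>tr\<close> makes the map from I to the double cosets surjective and
  uniqueness makes it injective, so the defining sum can be reindexed over I.\<close>

lemma (in group) pullback_elem_transversal:
  assumes H: "subgroup H G" and \<alpha>: "\<alpha> \<in> carrier G"
    and r: "\<And>i. i \<in> I \<Longrightarrow> r i \<in> carrier G"
    and tr: "\<And>g. g \<in> carrier G \<Longrightarrow> \<exists>!i. i \<in> I \<and> (\<exists>k::int. g \<otimes> \<alpha> [^] k \<otimes> inv (r i) \<in> H)"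
    and ret: "\<And>i. i \<in> I \<Longrightarrow> \<exists>k::nat. 0 < k \<and> r i \<otimes> \<alpha> [^] k \<otimes> inv (r i) \<in> H"
  shows "pullback_elem G H \<alpha> = (\<Sum>i\<in>I. pullback_term G H \<alpha> (r i))"
proof -
  let ?D = "\<lambda>g. (H #> g) <#> generate G {\<alpha>}"
  have tr': "\<exists>!i. i \<in> I \<and> g \<in> ?D (r i)" if "g \<in> carrier G" for g
    using tr[OF that] mem_double_coset_iff[OF H \<alpha> r that] by (metis (no_types, lifting))
  have "inj_on (\<lambda>i. ?D (r i)) I"
    using tr' r double_coset_self[OF H \<alpha>] by (intro inj_onI) metis
  moreover have "(\<lambda>i. ?D (r i)) ` I = double_cosets G H (generate G {\<alpha>})"
  proof
    show "(\<lambda>i. ?D (r i)) ` I \<subseteq> double_cosets G H (generate G {\<alpha>})"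
      using r by (auto simp: double_cosets_def)
    show "double_cosets G H (generate G {\<alpha>}) \<subseteq> (\<lambda>i. ?D (r i)) ` I"
    proof
      fix s assume "s \<in> double_cosets G H (generate G {\<alpha>})"
      then obtain g where g: "g \<in> carrier G" "s = ?D g"
        by (auto simp: double_cosets_def)
      obtain i where "i \<in> I" "g \<in> ?D (r i)"
        using tr'[OF g(1)] by blast
      then show "s \<in> (\<lambda>i. ?D (r i)) ` I"
        using double_coset_eq[OF H \<alpha> r] g(2) by blast
    qed
  qed
  ultimately have bij: "bij_betw (\<lambda>i. ?D (r i)) I (double_cosets G H (generate G {\<alpha>}))"
    by (simp add: bij_betw_def)
  have "pullback_elem G H \<alpha>
      = (\<Sum>s\<in>double_cosets G H (generate G {\<alpha>}). pullback_term G H \<alpha> (SOME g. g \<in> s))"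
    by (simp add: pullback_elem_def pullback_term_def Let_def)
  also have "\<dots> = (\<Sum>i\<in>I. pullback_term G H \<alpha> (SOME g. g \<in> ?D (r i)))"
    by (rule sum.reindex_bij_betw[OF bij, symmetric])
  also have "\<dots> = (\<Sum>i\<in>I. pullback_term G H \<alpha> (r i))"
  proof (rule sum.cong)
    fix i assume i: "i \<in> I"
    have "(SOME g. g \<in> ?D (r i)) \<in> ?D (r i)"
      using double_coset_self[OF H \<alpha> r[OF i]] by (rule someI)
    then show "pullback_term G H \<alpha> (SOME g. g \<in> ?D (r i)) = pullback_term G H \<alpha> (r i)"
      using pullback_term_double_coset[OF H \<alpha> r[OF i]] ret[OF i] by blast
  qed simp
  finally show ?thesis .
qed

lemma (in group) conj_int_pow:
  assumes "a \<in> carrier G" "c \<in> carrier G"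
  shows "(c \<otimes> a \<otimes> inv c) [^] (k::int) = c \<otimes> a [^] k \<otimes> inv c"
proof -
  have "(\<lambda>x. c \<otimes> x \<otimes> inv c) \<in> hom G G"
    using assms(2) by (auto simp: hom_def m_assoc inv_cancel_left)
  then interpret group_hom G G "\<lambda>x. c \<otimes> x \<otimes> inv c"
    by unfold_locales
  show ?thesis
    using hom_int_pow[OF assms(1), of k] by (rule sym)
qed

text \<open>If \<open>r\<close> is a transversal for \<open>\<alpha>\<close> then \<open>r c\<inverse>\<close> is one for \<open>c \<alpha> c\<inverse>\<close>, with the
  same summands; so the choice of a representative of the class does not matter.\<close>

lemma (in group) pullback_transversal:
  assumes H: "subgroup H G" and \<alpha>: "\<alpha> \<in> carrier G"
    and r: "\<And>i. i \<in> I \<Longrightarrow> r i \<in> carrier G"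
    and tr: "\<And>g. g \<in> carrier G \<Longrightarrow> \<exists>!i. i \<in> I \<and> (\<exists>k::int. g \<otimes> \<alpha> [^] k \<otimes> inv (r i) \<in> H)"
    and ret: "\<And>i. i \<in> I \<Longrightarrow> \<exists>k::nat. 0 < k \<and> r i \<otimes> \<alpha> [^] k \<otimes> inv (r i) \<in> H"
  shows "pullback G H (frag_of (conj_class G \<alpha>)) = (\<Sum>i\<in>I. pullback_term G H \<alpha> (r i))"
proof -
  obtain c where c: "c \<in> carrier G" "(SOME b. b \<in> conj_class G \<alpha>) = c \<otimes> \<alpha> \<otimes> inv c"
    using some_conj_class[OF \<alpha>] by blast
  define \<beta> where "\<beta> = c \<otimes> \<alpha> \<otimes> inv c"
  define r' where "r' i = r i \<otimes> inv c" for i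
  have \<beta>: "\<beta> \<in> carrier G"
    using \<alpha> c by (simp add: \<beta>_def)
  have \<beta>int: "\<beta> [^] k = c \<otimes> \<alpha> [^] k \<otimes> inv c" for k :: int
    unfolding \<beta>_def using \<alpha> c(1) by (rule conj_int_pow)
  have \<beta>pow: "\<beta> [^] k = c \<otimes> \<alpha> [^] k \<otimes> inv c" for k :: nat
    using \<beta>int[of "int k"] by (simp add: int_pow_int)
  have conj: "r' i \<otimes> \<beta> [^] k \<otimes> inv (r' i) = r i \<otimes> \<alpha> [^] k \<otimes> inv (r i)"
    if "i \<in> I" for i and k :: nat
    using r[OF that] \<alpha> c(1) by (simp add: r'_def \<beta>pow m_assoc inv_mult_group inv_cancel_left)
  have trans: "g \<otimes> \<beta> [^] k \<otimes> inv (r' i) = g \<otimes> c \<otimes> \<alpha> [^] k \<otimes> inv (r i)"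
    if "i \<in> I" "g \<in> carrier G" for i g and k :: int
    using r[OF that(1)] that(2) \<alpha> c(1)
    by (simp add: r'_def \<beta>int m_assoc inv_mult_group inv_cancel_left)
  have "pullback G H (frag_of (conj_class G \<alpha>)) = pullback_elem G H \<beta>"
    by (simp add: pullback_def c(2) \<beta>_def)
  also have "\<dots> = (\<Sum>i\<in>I. pullback_term G H \<beta> (r' i))"
  proof (rule pullback_elem_transversal[OF H \<beta>])
    show "\<exists>!i. i \<in> I \<and> (\<exists>k::int. g \<otimes> \<beta> [^] k \<otimes> inv (r' i) \<in> H)" if g: "g \<in> carrier G" for g
    proof -
      have "(i \<in> I \<and> (\<exists>k::int. g \<otimes> \<beta> [^] k \<otimes> inv (r' i) \<in> H)) \<longleftrightarrow>
            (i \<in> I \<and> (\<exists>k::int. g \<otimes> c \<otimes> \<alpha> [^] k \<otimes> inv (r i) \<in> H))" for i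
        using trans[OF _ g] by auto
      \<comment> \<open>By \<open>trans\<close>, the condition on g for \<beta> and
        \<open>r'\<close> is the condition on g c for \<alpha> and \<open>r\<close>.\<close>
      then show ?thesis
        using tr[of "g \<otimes> c"] g c(1) by simp
    qed
  qed (use r c(1) conj ret in \<open>auto simp: r'_def\<close>)
  also have "\<dots> = (\<Sum>i\<in>I. pullback_term G H \<alpha> (r i))"
    by (rule sum.cong) (simp_all add: pullback_term_def return_time_def conj)
  finally show ?thesis .
qed

section \<open>Matrices in the modular group\<close>

definition mat22 :: "'a \<Rightarrow> 'a \<Rightarrow> 'a \<Rightarrow> 'a \<Rightarrow> 'a::zero^2^2" where
  "mat22 a b c d = vector [vector [a, b], vector [c, d]]"

lemma mat22_nth [simp]:
  "mat22 a b c d $ 1 $ 1 = a" "mat22 a b c d $ 1 $ 2 = b"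
  "mat22 a b c d $ 2 $ 1 = c" "mat22 a b c d $ 2 $ 2 = d"
  by (simp_all add: mat22_def)

lemma mat22_eta: "A = mat22 (A $ 1 $ 1) (A $ 1 $ 2) (A $ 2 $ 1) (A $ 2 $ 2)"
  by (simp add: vec_eq_iff forall_2)

lemma mat22_cases:
  obtains a b c d where "A = mat22 a b c d"
  using mat22_eta by blast

lemma mat22_eq_iff:
  "mat22 a b c d = mat22 a' b' c' d' \<longleftrightarrow> a = a' \<and> b = b' \<and> c = c' \<and> d = d'"
  by (auto simp: vec_eq_iff forall_2)

lemma mat22_mult:
  "mat22 a b c d ** mat22 a' b' c' d' =
     mat22 (a * a' + b * c') (a * b' + b * d') (c * a' + d * c') (c * b' + d * (d' :: 'a::semiring_1))"
  by (simp add: vec_eq_iff forall_2 matrix_matrix_mult_def sum_2)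

lemma mat_1_eq_mat22: "mat 1 = mat22 1 0 0 (1 :: 'a::zero_neq_one)"
  by (simp add: vec_eq_iff forall_2 mat_def)

lemma map_matrix_mat22: "map_matrix f (mat22 a b c d) = mat22 (f a) (f b) (f c) (f d)"
  by (simp add: vec_eq_iff forall_2)

lemma mat22_in_SL2Z: "mat22 a b c d \<in> carrier SL2Z \<longleftrightarrow> a * d - b * c = 1"
  by (simp add: SL2Z_def det_2)

lemma SL2Z_mult: "A \<otimes>\<^bsub>SL2Z\<^esub> B = A ** B"
  by (simp add: SL2Z_def)

lemma SL2Z_one: "\<one>\<^bsub>SL2Z\<^esub> = mat22 1 0 0 1"
  by (simp add: SL2Z_def mat_1_eq_mat22)

section \<open>The group structure of SL2(Z) and the subgroup Gamma0(p)\<close>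

interpretation SL2Z: group SL2Z
proof (rule groupI)
  fix A assume A: "A \<in> carrier SL2Z"
  obtain a b c d where "A = mat22 a b c d" by (rule mat22_cases)
  \<comment> \<open>The witness is the adjugate, which is the inverse because the determinant is
    1.\<close>
  with A show "\<exists>B\<in>carrier SL2Z. B \<otimes>\<^bsub>SL2Z\<^esub> A = \<one>\<^bsub>SL2Z\<^esub>"
    by (intro bexI[of _ "mat22 d (-b) (-c) a"])
      (auto simp: SL2Z_mult SL2Z_one mat22_in_SL2Z mat22_mult mat22_eq_iff algebra_simps)
qed (auto simp: SL2Z_def det_mul matrix_mul_assoc)

lemma SL2Z_inv:
  assumes "mat22 a b c d \<in> carrier SL2Z"
  shows "inv\<^bsub>SL2Z\<^esub> (mat22 a b c d) = mat22 d (-b) (-c) a"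
  using assms
  by (intro SL2Z.inv_equality)
    (auto simp: SL2Z_mult SL2Z_one mat22_in_SL2Z mat22_mult mat22_eq_iff algebra_simps)

lemma mat22_in_Gamma0: "mat22 a b c d \<in> Gamma0 p \<longleftrightarrow> a * d - b * c = 1 \<and> int p dvd c"
  by (simp add: Gamma0_def mat22_in_SL2Z)

lemma subgroup_Gamma0: "subgroup (Gamma0 p) SL2Z"
proof (rule SL2Z.subgroupI)
  show "Gamma0 p \<noteq> {}"
    using mat22_in_Gamma0[of 1 0 0 1 p] by auto
next
  fix A assume A: "A \<in> Gamma0 p"
  obtain a b c d where "A = mat22 a b c d" by (rule mat22_cases)
  with A show "inv\<^bsub>SL2Z\<^esub> A \<in> Gamma0 p"
    by (simp add: mat22_in_Gamma0 SL2Z_inv mat22_in_SL2Z algebra_simps)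
next
  fix A B assume *: "A \<in> Gamma0 p" "B \<in> Gamma0 p"
  then have "A \<otimes>\<^bsub>SL2Z\<^esub> B \<in> carrier SL2Z"
    by (simp add: Gamma0_def)
  then show "A \<otimes>\<^bsub>SL2Z\<^esub> B \<in> Gamma0 p"
    using * by (simp add: Gamma0_def SL2Z_mult matrix_matrix_mult_def sum_2)
qed (auto simp: Gamma0_def)

text \<open>The sign s multiplies the whole unipotent matrix, hence the entry s * m: under powers
  the sign is then multiplicative and m additive, independently of each other.\<close>

definition parab :: "int \<Rightarrow> int \<Rightarrow> int^2^2" where
  "parab s m = mat22 s (s * m) 0 s"

definition parab_low :: "int \<Rightarrow> int \<Rightarrow> int^2^2" where
  "parab_low s m = mat22 s 0 (s * m) s"

lemma sigma_class_eq: "sigma_class \<epsilon> n = frag_of (conj_class SL2Z (parab \<epsilon> n))"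
  by (simp add: sigma_class_def parab_def map_matrix_mat22 flip: mat22_def)

lemma unit_int_dvd: "s \<in> {1, -1 :: int} \<Longrightarrow> a dvd s * b \<longleftrightarrow> a dvd b"
  by auto

lemma parab_in_SL2Z: "s \<in> {1, -1} \<Longrightarrow> parab s m \<in> carrier SL2Z"
  by (auto simp: parab_def mat22_in_SL2Z)

lemma parab_nat_pow: "parab s m [^]\<^bsub>SL2Z\<^esub> (k::nat) = parab (s ^ k) (int k * m)"
proof (induction k)
  case 0
  show ?case by (simp add: parab_def SL2Z_one)
next
  case (Suc k)
  then show ?case
    by (simp add: SL2Z_mult parab_def mat22_mult mat22_eq_iff algebra_simps)
qed

text \<open>The sign t is left unspecified: membership in \<open>Gamma0 p\<close> is a divisibility
  condition, and a unit factor does not change it.\<close>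

lemma parab_int_pow:
  assumes "s \<in> {1, -1}"
  obtains t where "t \<in> {1, -1}" "parab s m [^]\<^bsub>SL2Z\<^esub> (k::int) = parab t (k * m)"
proof -
  have sp: "s ^ j \<in> {1, -1}" for j :: nat
    using assms by (cases "even j") auto
  show ?thesis
  proof (cases "k \<ge> 0")
    case True
    then have "parab s m [^]\<^bsub>SL2Z\<^esub> k = parab (s ^ nat k) (k * m)"
      using parab_nat_pow[of s m "nat k"] by (simp flip: int_pow_int)
    then show ?thesis using that sp by blast
  next
    case False
    have inv: "inv\<^bsub>SL2Z\<^esub> (parab t l) = parab t (- l)" if "t \<in> {1, -1}" for t l
      using parab_in_SL2Z[OF that] by (simp add: parab_def SL2Z_inv)
    have "parab s m [^]\<^bsub>SL2Z\<^esub> k = inv\<^bsub>SL2Z\<^esub> (parab s m [^]\<^bsub>SL2Z\<^esub> nat (- k))"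
      using False SL2Z.int_pow_neg_int[OF parab_in_SL2Z[OF assms], of m "nat (- k)"] by simp
    also have "\<dots> = parab (s ^ nat (- k)) (k * m)"
      using False by (simp add: parab_nat_pow inv sp[simplified])
    finally show ?thesis using that sp by blast
  qed
qed

text \<open>Representatives of the right cosets of \<open>Gamma0 p\<close>: the coset of \<open>coset_rep p i\<close> is
  the point \<open>(1 : i)\<close> of the projective line over the field with \<open>p\<close> elements if \<open>i < p\<close>, and
  \<open>(0 : 1)\<close> if \<open>i = p\<close>.\<close>

definition coset_rep :: "nat \<Rightarrow> nat \<Rightarrow> int^2^2" where
  "coset_rep p i = (if i = p then mat22 1 0 0 1 else mat22 0 (-1) 1 (int i))"

lemma coset_rep_in_SL2Z: "coset_rep p i \<in> carrier SL2Z"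
  by (simp add: coset_rep_def mat22_in_SL2Z)

text \<open>Only the lower left entry matters. The bottom row of g times the parabolic element is s
  (c, c m + d), and the condition says that this row represents the same point of the projective
  line as (1 : i), or as (0 : 1) if i = p.\<close>

lemma coset_rep_parab_mem:
  assumes "s \<in> {1, -1}" and g: "mat22 a b c d \<in> carrier SL2Z"
  shows "mat22 a b c d \<otimes>\<^bsub>SL2Z\<^esub> parab s m \<otimes>\<^bsub>SL2Z\<^esub> inv\<^bsub>SL2Z\<^esub> coset_rep p i \<in> Gamma0 p
     \<longleftrightarrow> int p dvd (if i = p then c else c * int i - c * m - d)"
proof -
  let ?A = "mat22 a b c d \<otimes>\<^bsub>SL2Z\<^esub> parab s m \<otimes>\<^bsub>SL2Z\<^esub> inv\<^bsub>SL2Z\<^esub> coset_rep p i"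
  have "?A \<in> carrier SL2Z"
    using g parab_in_SL2Z[OF assms(1)] coset_rep_in_SL2Z by simp
  moreover have "?A $ 2 $ 1 = s * (if i = p then c else c * int i - c * m - d)"
    by (simp add: coset_rep_def SL2Z_inv mat22_in_SL2Z SL2Z_mult parab_def mat22_mult algebra_simps)
  ultimately show ?thesis
    using unit_int_dvd[OF assms(1)] by (simp add: Gamma0_def)
qed

lemma coset_rep_parab_orbit:
  assumes "s \<in> {1, -1}" and "mat22 a b c d \<in> carrier SL2Z"
  shows "(\<exists>k::int. mat22 a b c d \<otimes>\<^bsub>SL2Z\<^esub> parab s n [^]\<^bsub>SL2Z\<^esub> k \<otimes>\<^bsub>SL2Z\<^esub> inv\<^bsub>SL2Z\<^esub> coset_rep p i \<in> Gamma0 p)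
     \<longleftrightarrow> (\<exists>k. int p dvd (if i = p then c else c * int i - c * (k * n) - d))"
proof -
  have "mat22 a b c d \<otimes>\<^bsub>SL2Z\<^esub> parab s n [^]\<^bsub>SL2Z\<^esub> k \<otimes>\<^bsub>SL2Z\<^esub> inv\<^bsub>SL2Z\<^esub> coset_rep p i \<in> Gamma0 p
     \<longleftrightarrow> int p dvd (if i = p then c else c * int i - c * (k * n) - d)" for k :: int
    using parab_int_pow[OF assms(1), of n k] coset_rep_parab_mem[OF _ assms(2)] by metis
  then show ?thesis by simp
qed

text \<open>The result does not depend on i below p: (0 -1; 1 i) is (0 -1; 1 0) times (1 i; 0 1),
  and the second factor commutes with the parabolic element. This is why the p points (1 : i) give
  equal terms when all are fixed.\<close>

lemma conj_coset_rep_parab: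
  "coset_rep p i \<otimes>\<^bsub>SL2Z\<^esub> parab s m \<otimes>\<^bsub>SL2Z\<^esub> inv\<^bsub>SL2Z\<^esub> coset_rep p i =
     (if i = p then parab s m else parab_low s (- m))"
  by (simp add: coset_rep_def SL2Z_inv mat22_in_SL2Z SL2Z_mult parab_def parab_low_def
      mat22_mult mat22_eq_iff algebra_simps)

lemma parab_in_Gamma0: "s \<in> {1, -1} \<Longrightarrow> parab s m \<in> Gamma0 p"
  by (auto simp: parab_def mat22_in_Gamma0)

lemma parab_low_in_Gamma0: "s \<in> {1, -1} \<Longrightarrow> parab_low s m \<in> Gamma0 p \<longleftrightarrow> int p dvd m"
  by (auto simp: parab_low_def mat22_in_Gamma0)

lemma conj_coset_rep_parab_pow_mem:
  assumes "s \<in> {1, -1}"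
  shows "coset_rep p i \<otimes>\<^bsub>SL2Z\<^esub> parab s n [^]\<^bsub>SL2Z\<^esub> (k::nat) \<otimes>\<^bsub>SL2Z\<^esub> inv\<^bsub>SL2Z\<^esub> coset_rep p i \<in> Gamma0 p
     \<longleftrightarrow> i = p \<or> int p dvd int k * n"
proof -
  have "s ^ k \<in> {1, -1}"
    using assms by (cases "even k") auto
  then show ?thesis
    by (simp only: parab_nat_pow conj_coset_rep_parab)
      (auto simp: parab_in_Gamma0 parab_low_in_Gamma0)
qed

lemma return_time_parab:
  assumes "s \<in> {1, -1}"
  shows "return_time SL2Z (Gamma0 p) (parab s n) (coset_rep p i) =
    (LEAST k. 0 < k \<and> (i = p \<or> int p dvd int k * n))"
  by (simp only: return_time_def conj_coset_rep_parab_pow_mem[OF assms])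

lemma pullback_term_parab:
  "pullback_term SL2Z (Gamma0 p) (parab s n) (coset_rep p i) =
     (let k = return_time SL2Z (Gamma0 p) (parab s n) (coset_rep p i) in
      frag_of (conj_class (SL2Z\<lparr>carrier := Gamma0 p\<rparr>)
        (if i = p then parab (s ^ k) (int k * n) else parab_low (s ^ k) (- (int k * n)))))"
  by (simp only: pullback_term_def parab_nat_pow conj_coset_rep_parab Let_def)

section \<open>Orbits of a parabolic element and its pullback\<close>

lemma SL2Z_prime_dvd_bottom:
  assumes "prime p" "mat22 a b c d \<in> carrier SL2Z" "int p dvd c"
  shows "\<not> int p dvd d"
proof
  assume "int p dvd d"
  then have "int p dvd a * d - b * c"
    using assms(3) by simp
  then show False
    using assms(1,2) by (simp add: mat22_in_SL2Z not_prime_unit)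
qed

text \<open>The index set lists one point per orbit: every index if all points are fixed, otherwise
  0 for the long orbit and p for (0 : 1). The transversal property is checked on the bottom row (c,
  d) of g, read as a point (c : d).\<close>

lemma pullback_sigma_class:
  assumes p: "prime p" and s: "s \<in> {1, -1}"
    and I: "I = (if int p dvd n then {..p} else {0, p})"
  shows "pullback SL2Z (Gamma0 p) (sigma_class s n) =
     (\<Sum>i\<in>I. pullback_term SL2Z (Gamma0 p) (parab s n) (coset_rep p i))"
  unfolding sigma_class_eq
proof (rule SL2Z.pullback_transversal[OF subgroup_Gamma0])
  have p0: "p > 0" and pp: "prime (int p)"
    using p by (auto simp: prime_gt_0_nat)
  show "\<exists>k::nat. 0 < k \<and>
      coset_rep p i \<otimes>\<^bsub>SL2Z\<^esub> parab s n [^]\<^bsub>SL2Z\<^esub> k \<otimes>\<^bsub>SL2Z\<^esub> inv\<^bsub>SL2Z\<^esub> coset_rep p i \<in> Gamma0 p" for i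
    \<comment> \<open>The exponent p brings back every representative, since p divides p n.\<close>
    using p0 by (intro exI[of _ p]) (simp add: conj_coset_rep_parab_pow_mem[OF s])
  fix g assume g: "g \<in> carrier SL2Z"
  obtain a b c d where g_eq: "g = mat22 a b c d" by (rule mat22_cases)
  have "\<exists>!i. i \<in> I \<and> (\<exists>k. int p dvd (if i = p then c else c * int i - c * (k * n) - d))"
  proof (cases "int p dvd c")
    case True
    then have d: "\<not> int p dvd d"
      using SL2Z_prime_dvd_bottom p g g_eq by blast
    \<comment> \<open>With p dividing c, the condition for (1 : i) would force p to divide d as
      well, so only the index p remains.\<close>
    have "\<not> int p dvd c * x - c * y - d" for x y
    proof
      assume "int p dvd c * x - c * y - d"
      moreover have "int p dvd c * x - c * y"
        using True by simp
      ultimately have "int p dvd (c * x - c * y) - (c * x - c * y - d)"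
        by (rule dvd_diff[rotated])
      then show False using d by simp
    qed
    then show ?thesis
      using True by (intro ex1I[of _ p]) (auto simp: I split: if_splits)
  next
    case cF: False
    then have cop: "coprime c (int p)"
      using pp by (metis prime_imp_coprime coprime_commute)
    show ?thesis
    proof (cases "int p dvd n")
      case True
      \<comment> \<open>Since p divides n, the powers of the parabolic element do not move the
        point, and k drops out.\<close>
      have red: "int p dvd c * x - c * (k * n) - d \<longleftrightarrow> int p dvd c * x - d" for x k
      proof -
        have "c * x - c * (k * n) - d = (c * x - d) - c * k * n"
          by (simp add: algebra_simps)
        moreover have "int p dvd c * k * n"
          using True by simp
        ultimately show ?thesis
          by (metis dvd_diff_right_iff dvd_add_left_iff diff_add_cancel)
      qed
      \<comment> \<open>The affine coordinate x is d / c modulo p; its residue is the required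
        index.\<close>
      obtain x where x: "[c * x = d] (mod int p)"
        using cong_solve_coprime_int[OF cop] by (metis cong_scalar_right mult.assoc mult_1)
      define i where "i = nat (x mod int p)"
      have i: "i < p" "int i = x mod int p"
        using p0 by (simp_all add: i_def nat_less_iff)
      have "[c * int i = d] (mod int p)"
        using x unfolding i(2) by (simp add: cong_def mod_mult_right_eq)
      then have id: "int p dvd c * int i - d"
        by (simp add: cong_iff_dvd_diff)
      show ?thesis
      proof (rule ex1I[of _ i])
        show "i \<in> I \<and> (\<exists>k. int p dvd (if i = p then c else c * int i - c * (k * n) - d))"
          using i(1) id True by (simp add: I red)
        fix j assume j: "j \<in> I \<and> (\<exists>k. int p dvd (if j = p then c else c * int j - c * (k * n) - d))"
        then have jp: "j < p" and jd: "int p dvd c * int j - d"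
          using cF True by (auto simp: I red split: if_splits)
        have "int p dvd c * (int j - int i)"
          using dvd_diff[OF jd id] by (simp add: algebra_simps)
        then have "[int j = int i] (mod int p)"
          using pp cF by (simp add: prime_dvd_mult_iff cong_iff_dvd_diff)
        then show "j = i"
          using jp i(1) by (simp add: cong_int_iff cong_less_modulus_unique_nat)
      qed
    next
      case False
      \<comment> \<open>With c n invertible modulo p, the translation by k n with k = -d / (c n)
        moves the affine coordinate d / c to 0, so g belongs to the orbit of index 0.\<close>
      then have "coprime (c * n) (int p)"
        using cop pp by (metis prime_imp_coprime coprime_commute coprime_mult_left_iff)
      then obtain k where "[c * n * k = - d] (mod int p)"
        using cong_solve_coprime_int by (metis cong_scalar_right mult.assoc mult_1)
      then have "int p dvd c * n * k + d"
        by (simp add: cong_iff_dvd_diff)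
      then have "int p dvd - (c * n * k + d)"
        by (simp only: dvd_minus_iff)
      moreover have "- (c * n * k + d) = c * int 0 - c * (k * n) - d"
        by simp
      ultimately have "int p dvd c * int 0 - c * (k * n) - d"
        by (simp only:)
      then show ?thesis
        using cF False p0 by (intro ex1I[of _ 0]) (auto simp: I split: if_splits)
    qed
  qed
  then show "\<exists>!i. i \<in> I \<and> (\<exists>k::int. g \<otimes>\<^bsub>SL2Z\<^esub> parab s n [^]\<^bsub>SL2Z\<^esub> k \<otimes>\<^bsub>SL2Z\<^esub> inv\<^bsub>SL2Z\<^esub> coset_rep p i \<in> Gamma0 p)"
    using coset_rep_parab_orbit[OF s] g by (simp add: g_eq)
qed (use s parab_in_SL2Z coset_rep_in_SL2Z in auto)

lemma Least_pos_dvd_mult: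
  assumes "prime p" "\<not> int p dvd n"
  shows "(LEAST k::nat. 0 < k \<and> int p dvd int k * n) = p"
proof (rule Least_equality)
  show "0 < p \<and> int p dvd int p * n"
    using assms(1) by (simp add: prime_gt_0_nat)
  fix k :: nat assume k: "0 < k \<and> int p dvd int k * n"
  then have "p dvd k"
    using assms by (simp add: prime_dvd_mult_iff)
  then show "p \<le> k"
    using k by (simp add: dvd_imp_le)
qed

lemma pullback_sigma_class_not_dvd:
  assumes p: "prime p" and s: "s \<in> {1, -1}" and n: "\<not> int p dvd n"
  shows "pullback SL2Z (Gamma0 p) (sigma_class s n) =
     frag_of (conj_class (SL2Z\<lparr>carrier := Gamma0 p\<rparr>) (parab s n)) +
     frag_of (conj_class (SL2Z\<lparr>carrier := Gamma0 p\<rparr>) (parab_low (s ^ p) (- (int p * n))))"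
proof -
  \<comment> \<open>This keeps the indices 0 and p distinct, so the sum has two terms: index p has
    return time 1, index 0 has return time p.\<close>
  have "p \<noteq> 0" using p by auto
  moreover have "(LEAST k::nat. 0 < k) = 1"
    by (rule Least_equality) auto
  ultimately show ?thesis
    using pullback_sigma_class[OF p s refl, of n] n Least_pos_dvd_mult[OF p n]
    by (simp add: pullback_term_parab return_time_parab[OF s] Let_def add.commute)
qed

lemma pullback_sigma_class_dvd:
  assumes p: "prime p" and s: "s \<in> {1, -1}" and n: "int p dvd n"
  shows "pullback SL2Z (Gamma0 p) (sigma_class s n) =
     frag_of (conj_class (SL2Z\<lparr>carrier := Gamma0 p\<rparr>) (parab s n)) +
     frag_cmul (int p) (frag_of (conj_class (SL2Z\<lparr>carrier := Gamma0 p\<rparr>) (parab_low s (- n))))"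
proof -
  let ?L = "frag_of (conj_class (SL2Z\<lparr>carrier := Gamma0 p\<rparr>) (parab_low s (- n)))"
  have sum_const: "(\<Sum>i<m. ?L) = frag_cmul (int m) ?L" for m :: nat
    by (induction m) (simp_all add: frag_cmul_distrib del: sum_constant)
  have "(LEAST k::nat. 0 < k) = 1"
    by (rule Least_equality) auto
  then have "return_time SL2Z (Gamma0 p) (parab s n) (coset_rep p i) = 1" for i
    using n by (simp add: return_time_parab[OF s])
  then have "pullback SL2Z (Gamma0 p) (sigma_class s n) =
      (\<Sum>i\<le>p. frag_of (conj_class (SL2Z\<lparr>carrier := Gamma0 p\<rparr>)
        (if i = p then parab s n else parab_low s (- n))))"
    using pullback_sigma_class[OF p s refl, of n] n by (simp add: pullback_term_parab Let_def cong: if_cong)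
  also have "\<dots> = frag_of (conj_class (SL2Z\<lparr>carrier := Gamma0 p\<rparr>) (parab s n)) + (\<Sum>i<p. ?L)"
    by (simp flip: lessThan_Suc_atMost add: add.commute)
  finally show ?thesis by (simp only: sum_const)
qed

section \<open>The two degeneracy maps\<close>

text \<open>\<open>matrix_inv\<close> chooses some two-sided inverse X, and X = X (A B) = B
  identifies it.\<close>

lemma matrix_inv_eqI:
  fixes A B :: "'a::semiring_1^'n^'n"
  assumes "A ** B = mat 1" "B ** A = mat 1"
  shows "matrix_inv A = B"
proof -
  have "A ** matrix_inv A = mat 1 \<and> matrix_inv A ** A = mat 1"
    unfolding matrix_inv_def by (rule someI[of _ B]) (use assms in simp)
  then have "matrix_inv A = matrix_inv A ** (A ** B)" "matrix_inv A ** A = mat 1"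
    using assms by simp_all
  then show ?thesis by (simp add: matrix_mul_assoc)
qed

lemma g_mat_eq: "g_mat p = mat22 (of_nat p) 0 0 1"
  by (simp add: g_mat_def mat22_def)

lemma matrix_inv_g_mat:
  assumes "p > 0"
  shows "matrix_inv (g_mat p) = mat22 (1 / of_nat p) 0 0 1"
  using assms by (intro matrix_inv_eqI) (simp_all add: g_mat_eq mat22_mult mat_1_eq_mat22)

text \<open>Conjugation by diag(p, 1) multiplies the upper right entry by p and divides the lower
  left one by p; writing the latter as p c avoids division. The description in \<open>pi_op\<close>
  is unique because the entrywise embedding of integers into rationals is injective.\<close>

lemma pi_op_mat22:
  assumes "p > 0"
  shows "pi_op p (mat22 a b (int p * c) d) = mat22 a (int p * b) c d"
proof -
  have inj: "map_matrix rat_of_int A = map_matrix rat_of_int B \<longleftrightarrow> A = B" for A B :: "int^2^2"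
    by (simp add: vec_eq_iff)
  have "g_mat p ** map_matrix rat_of_int (mat22 a b (int p * c) d) ** matrix_inv (g_mat p)
      = map_matrix rat_of_int (mat22 a (int p * b) c d)"
    using assms by (simp add: matrix_inv_g_mat map_matrix_mat22 mat22_mult mat22_eq_iff)
      (simp add: g_mat_eq mat22_mult mat22_eq_iff)
  then show ?thesis
    by (simp add: pi_op_def inj)
qed

lemma pi_op_hom:
  assumes "p > 0"
  shows "pi_op p \<in> hom (SL2Z\<lparr>carrier := Gamma0 p\<rparr>) SL2Z"
proof -
  have cases: "\<exists>a b c d. A = mat22 a b (int p * c) d \<and> a * d - b * (int p * c) = 1"
    if A: "A \<in> Gamma0 p" for A
  proof -
    obtain a b c d where "A = mat22 a b c d" by (rule mat22_cases)
    with A show ?thesis by (auto simp: mat22_in_Gamma0 dvd_def)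
  qed
  show ?thesis
  proof (rule homI)
    fix A assume "A \<in> carrier (SL2Z\<lparr>carrier := Gamma0 p\<rparr>)"
    then obtain a b c d where "A = mat22 a b (int p * c) d" "a * d - b * (int p * c) = 1"
      using cases[of A] by auto
    then show "pi_op p A \<in> carrier SL2Z"
      using assms by (simp add: pi_op_mat22) (simp add: mat22_in_SL2Z mult_ac)
  next
    fix A B assume "A \<in> carrier (SL2Z\<lparr>carrier := Gamma0 p\<rparr>)" "B \<in> carrier (SL2Z\<lparr>carrier := Gamma0 p\<rparr>)"
    then obtain a b c d a' b' c' d' where
      AB: "A = mat22 a b (int p * c) d" "B = mat22 a' b' (int p * c') d'"
      using cases[of A] cases[of B] by auto
    \<comment> \<open>The lower left entry of the product is displayed as a multiple of p, the form
      in which \<open>pi_op_mat22\<close> applies.\<close>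
    have "A ** B = mat22 (a * a' + b * (int p * c')) (a * b' + b * d')
        (int p * (c * a' + d * c')) (int p * c * b' + d * d')"
      by (simp add: AB mat22_mult mat22_eq_iff algebra_simps)
    then show "pi_op p (A \<otimes>\<^bsub>SL2Z\<lparr>carrier := Gamma0 p\<rparr>\<^esub> B) = pi_op p A \<otimes>\<^bsub>SL2Z\<^esub> pi_op p B"
      using assms by (simp add: SL2Z_mult pi_op_mat22 AB) (simp add: mat22_mult mat22_eq_iff algebra_simps)
  qed
qed

lemma pi_op_parab: "p > 0 \<Longrightarrow> pi_op p (parab s n) = parab s (n * int p)"
  using pi_op_mat22[of p s "s * n" 0 s] by (simp add: parab_def algebra_simps)

lemma pi_op_parab_low: "p > 0 \<Longrightarrow> pi_op p (parab_low s (int p * n)) = parab_low s n"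
  using pi_op_mat22[of p s 0 "s * n" s] by (simp add: parab_low_def algebra_simps)

text \<open>The conjugator is (0 -1; 1 0), obtained as \<open>coset_rep 1 0\<close> since the index
  0 differs from 1. For prime p it lies outside \<open>Gamma0 p\<close>, so this identification is
  used only after pushing forward to SL2(Z).\<close>

lemma conj_class_parab_low:
  assumes "s \<in> {1, -1}"
  shows "conj_class SL2Z (parab_low s (- m)) = conj_class SL2Z (parab s m)"
  using SL2Z.conj_class_conj[OF parab_in_SL2Z[OF assms, of m] coset_rep_in_SL2Z[of 1 0]]
  by (simp add: conj_coset_rep_parab)

section \<open>Evaluation of both operators\<close>

lemma pushforward_Gamma0:
  assumes "\<psi> \<in> hom (SL2Z\<lparr>carrier := Gamma0 p\<rparr>) SL2Z" "A \<in> Gamma0 p"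
  shows "pushforward SL2Z \<psi> (frag_of (conj_class (SL2Z\<lparr>carrier := Gamma0 p\<rparr>) A)) =
     frag_of (conj_class SL2Z (\<psi> A))"
  using pushforward_conj_class[OF SL2Z.subgroup_imp_group[OF subgroup_Gamma0] SL2Z.is_group] assms
  by simp

lemma pushforward_add: "pushforward K \<psi> (x + y) = pushforward K \<psi> x + pushforward K \<psi> y"
  by (simp add: pushforward_def frag_extend_add)

lemma pushforward_cmul: "pushforward K \<psi> (frag_cmul c x) = frag_cmul c (pushforward K \<psi> x)"
  by (simp add: pushforward_def frag_extend_cmul)

lemma inclusion_hom: "(\<lambda>A. A) \<in> hom (SL2Z\<lparr>carrier := Gamma0 p\<rparr>) SL2Z"
  by (auto simp: hom_def Gamma0_def)

theorem proposition10p8: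
  fixes p :: nat and \<epsilon> n :: int
  assumes "prime p" and "\<epsilon> \<in> {1, -1}"
  shows "e_op p (sigma_class \<epsilon> n) =
           (if \<not> int p dvd n then sigma_class (\<epsilon> ^ p) (n * int p)
            else frag_cmul (int p) (sigma_class \<epsilon> n))
       \<and> T_op p (sigma_class \<epsilon> n) =
           (if \<not> int p dvd n then sigma_class \<epsilon> (n * int p) + sigma_class (\<epsilon> ^ p) n
            else sigma_class \<epsilon> (n * int p) + frag_cmul (int p) (sigma_class \<epsilon> (n div int p)))"
proof -
  note p = assms(1) and \<epsilon> = assms(2)
  have p0: "p > 0"
    using p by (rule prime_gt_0_nat)
  have \<epsilon>p: "\<epsilon> ^ p \<in> {1, -1}"
    using \<epsilon> by (cases "even p") auto
  note push = pushforward_add pushforward_cmul pushforward_Gamma0[OF inclusion_hom]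
    pushforward_Gamma0[OF pi_op_hom[OF p0]] parab_in_Gamma0[OF \<epsilon>] pi_op_parab[OF p0]
  show ?thesis
  proof (cases "int p dvd n")
    case False
    have low: "parab_low (\<epsilon> ^ p) (- (int p * n)) \<in> Gamma0 p"
      using parab_low_in_Gamma0[OF \<epsilon>p] by simp
    have pi: "pi_op p (parab_low (\<epsilon> ^ p) (- (int p * n))) = parab_low (\<epsilon> ^ p) (- n)"
      using pi_op_parab_low[OF p0, of "\<epsilon> ^ p" "- n"] by simp
    \<comment> \<open>Under the inclusion the upper term becomes
      \<open>sigma_class \<epsilon> n\<close> and cancels against the subtracted identity, leaving
      parameter p n. Under \<open>pi_op\<close> the upper parameter becomes n p and the lower one
      returns from p n to n.\<close>
    show ?thesis
      unfolding e_op_def T_op_def pullback_sigma_class_not_dvd[OF p \<epsilon> False]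
      using False
      by (simp add: push low pi conj_class_parab_low[OF \<epsilon>p] sigma_class_eq mult.commute[of n "int p"])
  next
    case True
    then obtain m where m: "n = int p * m" ..
    have low: "parab_low \<epsilon> (- n) \<in> Gamma0 p"
      using parab_low_in_Gamma0[OF \<epsilon>] True by simp
    \<comment> \<open>With n = p m, \<open>pi_op\<close> removes the factor p, and
      \<open>n div int p\<close> is m because p is positive.\<close>
    have pi: "pi_op p (parab_low \<epsilon> (- n)) = parab_low \<epsilon> (- (n div int p))"
      using pi_op_parab_low[OF p0, of \<epsilon> "- m"] p0 by (simp add: m)
    show ?thesis
      unfolding e_op_def T_op_def pullback_sigma_class_dvd[OF p \<epsilon> True]
      using True
      by (simp add: push low pi conj_class_parab_low[OF \<epsilon>] sigma_class_eq)
  qed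
qed

end
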